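(* Let $r\ge 1$, $n=r+1$, and let $\tilde\alpha$ be the highest root of $\mathfrak{sl}_n=\mathfrak{sl}_n(\mathbb C)$. If $\mu\in P_+(\mathfrak{sl}_n)$ and $\mu\neq 0$, then $$\mathcal A(\tilde\alpha,\mu)=\begin{cases}\{1\} & \text{if }\mu=\tilde\alpha,\\ \emptyset & \text{otherwise.}\end{cases}$$
   Context: Setting: $\mathfrak g=\mathfrak{sl}_n(\mathbb C)$, with Cartan subalgebra $\mathfrak h$ of diagonal trace-zero matrices and Borel subalgebra of upper triangular trace-zero matrices. For $1\le i\le n$ let $\varepsilon_i\in\mathfrak h^*$ send a diagonal matrix to its $i$-th entry (so $\varepsilon_1+\cdots+\varepsilon_n=0$ on $\mathfrak h$). The Weyl group is $W=S_n$ (with identity $1$), acting on $\mathfrak h^*$ by $\sigma(\varepsilon_i)=\varepsilon_{\sigma(i)}$. The positive roots are $\Phi^+=\{\varepsilon_i-\varepsilon_j: 1\le i<j\le n\}$, the highest root is $\tilde\alpha=\varepsilon_1-\varepsilon_n$, and $\rho=\frac12\sum_{\alpha\in\Phi^+}\alpha$. The fundamental weights are $\varpi_i=\varepsilon_1+\cdots+\varepsilon_i$ for $1\le i\le r$, and the set of dominant integral weights is $P_+(\mathfrak{sl}_n)=\{a_1\varpi_1+\cdots+a_r\varpi_r: a_i\in\mathbb Z_{\ge 0}\}$. Kostant's partition function: for $\xi\in\mathfrak h^*$, $\wp(\xi)$ is the number of ways to write $\xi$ as a non-negative integral sum of positive roots (i.e. the number of functions $m:\Phi^+\to\{0,1,2,\dots\}$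 with $\sum_{\beta\in\Phi^+}m(\beta)\beta=\xi$). Weyl alternation set: for dominant integral weights $\lambda,\mu$, $\mathcal A(\lambda,\mu)=\{\sigma\in W:\wp(\sigma(\lambda+\rho)-(\mu+\rho))>0\}$. *)

theory Defs
  imports
    "Jordan_Normal_Form.Matrix"
    "HOL-Combinatorics.Permutations"
    "HOL-Library.Function_Algebras"
    "HOL-Library.FuncSet"
begin

definition sl :: "nat \<Rightarrow> complex mat set" where
  "sl n = {A \<in> carrier_mat n n. (\<Sum>i<n. A $$ (i, i)) = 0}"

definition cartan :: "nat \<Rightarrow> complex mat set" where
  "cartan n = {H \<in> sl n. diagonal_mat H}"

text \<open>
  An element of the dual space of \<open>cartan n\<close> is represented by the function on all matrices
  that is the given functional on \<open>cartan n\<close> and \<open>0\<close> elsewhere. Hence equality of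
  representatives is equality of functionals (in particular
  \<open>\<epsilon>\<^sub>1 + \<dots> + \<epsilon>\<^sub>n = 0\<close>, see below), and the vector space operations are the pointwise ones
  (sum, difference and zero are those of \<open>HOL-Library.Function_Algebras\<close>).
\<close>

type_synonym weight = "complex mat \<Rightarrow> complex"

definition scale :: "complex \<Rightarrow> weight \<Rightarrow> weight" where
  "scale c f = (\<lambda>H. c * f H)"

text \<open>Weights are indexed by \<open>1, \<dots>, n\<close>, whereas matrix entries are indexed from \<open>0\<close>.\<close>

definition eps :: "nat \<Rightarrow> nat \<Rightarrow> weight" where
  "eps n i = (\<lambda>H. if H \<in> cartan n then H $$ (i - 1, i - 1) else 0)"

definition pos_roots :: "nat \<Rightarrow> weight set" where
  "pos_roots n = {eps n i - eps n j | i j. 1 \<le> i \<and> i < j \<and> j \<le> n}"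

definition highest_root :: "nat \<Rightarrow> weight" where
  "highest_root n = eps n 1 - eps n n"

definition rho :: "nat \<Rightarrow> weight" where
  "rho n = scale (1 / 2) (\<Sum>\<alpha>\<in>pos_roots n. \<alpha>)"

definition fund_weight :: "nat \<Rightarrow> nat \<Rightarrow> weight" where
  "fund_weight n i = (\<Sum>k=1..i. eps n k)"

definition dominant_weights :: "nat \<Rightarrow> weight set" where
  "dominant_weights n =
     {\<Sum>i=1..n - 1. scale (of_nat (a i)) (fund_weight n i) | a :: nat \<Rightarrow> nat. True}"

definition weyl_group :: "nat \<Rightarrow> (nat \<Rightarrow> nat) set" where
  "weyl_group n = {\<sigma>. \<sigma> permutes {1..n}}"

text \<open>
  The action on the dual space is dual to permuting the entries of diagonal matrices: the
  \<open>i\<close>-th diagonal entry of \<open>permute_entries n \<sigma> H\<close> is the \<open>\<sigma> i\<close>-th one of \<open>H\<close>. It is the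
  linear action with \<open>\<sigma> (\<epsilon>\<^sub>i) = \<epsilon>\<^bsub>\<sigma> i\<^esub>\<close>; see \<open>weyl_act_eps\<close> below.
\<close>

definition permute_entries :: "nat \<Rightarrow> (nat \<Rightarrow> nat) \<Rightarrow> complex mat \<Rightarrow> complex mat" where
  "permute_entries n \<sigma> H = mat n n (\<lambda>(i, j). H $$ (\<sigma> (i + 1) - 1, \<sigma> (j + 1) - 1))"

definition weyl_act :: "nat \<Rightarrow> (nat \<Rightarrow> nat) \<Rightarrow> weight \<Rightarrow> weight" where
  "weyl_act n \<sigma> f = (\<lambda>H. if H \<in> cartan n then f (permute_entries n \<sigma> H) else 0)"

definition kostant_functions :: "nat \<Rightarrow> weight \<Rightarrow> (weight \<Rightarrow> nat) set" where
  "kostant_functions n \<xi> =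
     {m \<in> pos_roots n \<rightarrow>\<^sub>E UNIV. (\<Sum>\<beta>\<in>pos_roots n. scale (of_nat (m \<beta>)) \<beta>) = \<xi>}"

text \<open>The set counted here is always finite, see \<open>finite_kostant_functions\<close> below.\<close>

definition kostant_partition :: "nat \<Rightarrow> weight \<Rightarrow> nat" where
  "kostant_partition n \<xi> = card (kostant_functions n \<xi>)"

definition weyl_alternation_set :: "nat \<Rightarrow> weight \<Rightarrow> weight \<Rightarrow> (nat \<Rightarrow> nat) set" where
  "weyl_alternation_set n \<nu> \<mu> =
     {\<sigma> \<in> weyl_group n.
        kostant_partition n (weyl_act n \<sigma> (\<nu> + rho n) - (\<mu> + rho n)) > 0}"

lemma sum_weight_apply: "(\<Sum>x\<in>A. (f x :: weight)) H = (\<Sum>x\<in>A. f x H)"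
  by (induction A rule: infinite_finite_induct) auto

lemma sum_eps: "(\<Sum>i=1..n. eps n i) = 0"
proof
  fix H :: "complex mat"
  have "(\<Sum>i=1..n. H $$ (i - 1, i - 1)) = (\<Sum>i<n. H $$ (i, i))"
    by (rule sum.reindex_bij_witness[of _ Suc "\<lambda>i. i - 1"]) auto
  then show "(\<Sum>i=1..n. eps n i) H = (0 :: weight) H"
    by (cases "H \<in> cartan n") (simp_all add: sum_weight_apply eps_def, simp add: cartan_def sl_def)
qed

lemma permute_entries_cartan:
  assumes \<sigma>: "\<sigma> permutes {1..n}" and H: "H \<in> cartan n"
  shows "permute_entries n \<sigma> H \<in> cartan n"
proof -
  have rng: "1 \<le> \<sigma> (Suc i) \<and> \<sigma> (Suc i) \<le> n" if "i < n" for i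
    using permutes_in_image[OF \<sigma>, of "Suc i"] that by auto
  have "(\<Sum>i<n. H $$ (\<sigma> (i + 1) - 1, \<sigma> (i + 1) - 1)) = (\<Sum>i=1..n. H $$ (\<sigma> i - 1, \<sigma> i - 1))"
    by (rule sum.reindex_bij_witness[of _ "\<lambda>i. i - 1" Suc]) auto
  also have "\<dots> = (\<Sum>i=1..n. H $$ (i - 1, i - 1))"
    using sum.permute[OF \<sigma>, of "\<lambda>i. H $$ (i - 1, i - 1)"] by (simp add: comp_def)
  also have "\<dots> = (\<Sum>i<n. H $$ (i, i))"
    by (rule sum.reindex_bij_witness[of _ Suc "\<lambda>i. i - 1"]) auto
  also have "\<dots> = 0"
    using H by (auto simp: cartan_def sl_def)
  finally have tr: "(\<Sum>i<n. H $$ (\<sigma> (i + 1) - 1, \<sigma> (i + 1) - 1)) = 0" .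
  have "H $$ (\<sigma> (Suc i) - 1, \<sigma> (Suc j) - 1) = 0" if "i < n" "j < n" "i \<noteq> j" for i j
  proof -
    have "\<sigma> (Suc i) \<noteq> \<sigma> (Suc j)"
      using permutes_inj[OF \<sigma>] that by (auto dest: injD)
    with rng[OF that(1)] rng[OF that(2)]
    have "\<sigma> (Suc i) - 1 \<noteq> \<sigma> (Suc j) - 1" "\<sigma> (Suc i) - 1 < n" "\<sigma> (Suc j) - 1 < n"
      by linarith+
    then show ?thesis
      using H by (auto simp: cartan_def sl_def diagonal_mat_def)
  qed
  then show ?thesis
    using tr by (auto simp: cartan_def sl_def diagonal_mat_def permute_entries_def)
qed

lemma weyl_act_eps:
  assumes "\<sigma> permutes {1..n}" and "i \<in> {1..n}"
  shows "weyl_act n \<sigma> (eps n i) = eps n (\<sigma> i)"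
proof
  fix H
  show "weyl_act n \<sigma> (eps n i) H = eps n (\<sigma> i) H"
    using permute_entries_cartan[OF assms(1)] assms(2)
    by (auto simp: weyl_act_def eps_def permute_entries_def)
qed

lemma weyl_act_add: "weyl_act n \<sigma> (f + g) = weyl_act n \<sigma> f + weyl_act n \<sigma> g"
  by (auto simp: weyl_act_def fun_eq_iff)

lemma weyl_act_scale: "weyl_act n \<sigma> (scale c f) = scale c (weyl_act n \<sigma> f)"
  by (auto simp: weyl_act_def scale_def fun_eq_iff)

lemma finite_pos_roots: "finite (pos_roots n)"
proof -
  have "pos_roots n \<subseteq> (\<lambda>(i, j). eps n i - eps n j) ` ({1..n} \<times> {1..n})"
    by (force simp: pos_roots_def)
  then show ?thesis
    by (rule finite_subset) auto
qed

lemma finite_kostant_functions: "finite (kostant_functions n \<xi>)"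
proof -
  define c :: "nat \<Rightarrow> real" where "c i = real n - 1 - 2 * real i" for i
  define H :: "complex mat" where
    "H = mat n n (\<lambda>(i, j). if i = j then complex_of_real (c i) else 0)"
  have "(\<Sum>i<n. c i) = 0"
  proof -
    have "(\<Sum>i<k. c i) = real k * (real n - real k)" for k
      by (induction k) (auto simp: c_def algebra_simps)
    then show ?thesis by simp
  qed
  then have "(\<Sum>i<n. complex_of_real (c i)) = 0"
    by (metis of_real_0 of_real_sum)
  then have H: "H \<in> cartan n"
    by (auto simp: cartan_def sl_def diagonal_mat_def H_def)
  have pos: "Re (\<beta> H) \<ge> 1" if \<beta>: "\<beta> \<in> pos_roots n" for \<beta>
  proof -
    obtain i j where ij: "1 \<le> i" "i < j" "j \<le> n" "\<beta> = eps n i - eps n j"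
      using \<beta> unfolding pos_roots_def by blast
    then have "\<beta> H = complex_of_real (c (i - 1) - c (j - 1))"
      using H by (simp add: eps_def H_def)
    then show ?thesis
      using ij by (simp add: c_def of_nat_diff)
  qed
  have bound: "m \<beta> \<le> nat \<lfloor>Re (\<xi> H)\<rfloor>"
    if m: "m \<in> kostant_functions n \<xi>" and \<beta>: "\<beta> \<in> pos_roots n" for m \<beta>
  proof -
    have "\<xi> H = (\<Sum>\<beta>\<in>pos_roots n. of_nat (m \<beta>) * \<beta> H)"
      using m by (auto simp: kostant_functions_def sum_weight_apply scale_def)
    then have eq: "Re (\<xi> H) = (\<Sum>\<beta>\<in>pos_roots n. real (m \<beta>) * Re (\<beta> H))"
      by simp
    have "real (m \<beta>) \<le> real (m \<beta>) * Re (\<beta> H)"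
      using pos[OF \<beta>] by (simp add: mult_le_cancel_left1)
    also have "\<dots> \<le> Re (\<xi> H)"
      unfolding eq
    proof (rule member_le_sum[OF \<beta> _ finite_pos_roots])
      show "0 \<le> real (m \<gamma>) * Re (\<gamma> H)" if "\<gamma> \<in> pos_roots n - {\<beta>}" for \<gamma>
        using pos[of \<gamma>] that by simp
    qed
    finally show ?thesis
      by linarith
  qed
  have "kostant_functions n \<xi> \<subseteq> pos_roots n \<rightarrow>\<^sub>E {..nat \<lfloor>Re (\<xi> H)\<rfloor>}"
  proof
    fix m
    assume m: "m \<in> kostant_functions n \<xi>"
    then have "m \<in> extensional (pos_roots n)"
      by (simp add: kostant_functions_def PiE_iff)
    then show "m \<in> pos_roots n \<rightarrow>\<^sub>E {..nat \<lfloor>Re (\<xi> H)\<rfloor>}"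
      using bound[OF m] by (simp add: PiE_iff)
  qed
  then show ?thesis
    by (rule finite_subset) (intro finite_PiE finite_pos_roots finite_atMost)
qed

end

theory Submission
  imports Defs
begin

text \<open>
  Write \<open>\<lambda>\<close> for the highest root and \<open>H\<^sub>k\<close> (\<open>1 \<le> k < n\<close>) for the fundamental coweights, so
  that \<open>\<epsilon>\<^sub>i - \<epsilon>\<^sub>j\<close> takes the value \<open>1\<close> at \<open>H\<^sub>k\<close> if \<open>i \<le> k < j\<close> and \<open>0\<close> otherwise. Suppose that
  \<open>\<sigma>(\<lambda> + \<rho>) - (\<mu> + \<rho>)\<close> is a sum of positive roots. At \<open>H\<^sub>k\<close> this sum has a value \<open>N\<^sub>k \<in> \<nat>\<close>, so

    \<open>\<mu>(H\<^sub>k) = \<lambda>(H\<^sub>k) - d\<^sub>k - N\<^sub>k\<close>  where  \<open>d\<^sub>k = (\<lambda> + \<rho>)(H\<^sub>k) - \<sigma>(\<lambda> + \<rho>)(H\<^sub>k)\<close>.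

  Here \<open>\<lambda>(H\<^sub>k) = 1\<close>. The weight \<open>\<lambda> + \<rho>\<close> has strictly decreasing integral coordinates, so \<open>d\<^sub>k\<close>
  is the amount by which the sum of the first \<open>k\<close> coordinates exceeds the sum of some \<open>k\<close> of
  them (\<open>sum_less_sum_initial_segment\<close>), a non-negative integer. On the other hand
  \<open>\<mu>(H\<^sub>k) > 0\<close> because \<open>\<mu>\<close> is dominant and nonzero and every fundamental weight is positive at every
  fundamental coweight (\<open>dominant_weight_coweight_pos\<close>); this is the positivity of the entries of
  the inverse Cartan matrix. The only positive integer that is at most \<open>1\<close> is \<open>1\<close>, whence
  \<open>d\<^sub>k = N\<^sub>k = 0\<close> for all \<open>k\<close>.

  Now \<open>d\<^sub>k = 0\<close> for all \<open>k\<close> means that \<open>\<sigma>\<close> preserves every initial segment \<open>{1..k}\<close>, so \<open>\<sigma> = 1\<close>.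
  And \<open>N\<^sub>k = 0\<close> for all \<open>k\<close> means that no positive root occurs in the sum, so that
  \<open>\<lambda> + \<rho> = \<mu> + \<rho>\<close>. Conversely, for \<open>\<sigma> = 1\<close> and \<open>\<mu> = \<lambda>\<close> the empty sum is a solution.
\<close>

section \<open>Fundamental coweights\<close>

definition coweight :: "nat \<Rightarrow> nat \<Rightarrow> complex mat" where
  "coweight n k =
     mat n n (\<lambda>(i, j). if i = j then of_real (of_bool (i < k) - real k / real n) else 0)"

lemma coweight_in_cartan:
  assumes "0 < n" "k \<le> n"
  shows "coweight n k \<in> cartan n"
proof -
  have "(\<Sum>i<n. of_bool (i < k) - real k / real n) = real (card {i. i < n \<and> i < k}) - real k"
    using assms by (simp add: sum_subtractf sum.If_cases of_bool_def Int_def)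
  also have "{i. i < n \<and> i < k} = {..<k}"
    using assms by auto
  finally have "(\<Sum>i<n. of_bool (i < k) - real k / real n) = 0" by simp
  then have "(\<Sum>i<n. complex_of_real (of_bool (i < k) - real k / real n)) = 0"
    by (simp only: flip: of_real_sum) simp
  then show ?thesis
    by (auto simp: coweight_def cartan_def sl_def diagonal_mat_def)
qed

lemma eps_coweight:
  assumes "1 \<le> i" "i \<le> n" "k \<le> n"
  shows "eps n i (coweight n k) = of_real (of_bool (i \<le> k) - real k / real n)"
proof -
  have "(i - 1 < k) = (i \<le> k)" using assms by auto
  then show ?thesis
    using assms coweight_in_cartan[of n k] by (simp add: eps_def coweight_def)
qed

lemma root_coweight:
  assumes "1 \<le> i" "i < j" "j \<le> n" "k \<le> n"
  shows "(eps n i - eps n j) (coweight n k) = of_bool (i \<le> k \<and> k < j)"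
  using assms by (auto simp: eps_coweight)

text \<open>
  The value is \<open>min i k - i * k / n\<close>, the \<open>(i, k)\<close> entry of the inverse Cartan matrix.
\<close>

lemma fund_weight_coweight_pos:
  assumes "1 \<le> i" "i < n" "1 \<le> k" "k < n"
  shows "\<exists>x>0. fund_weight n i (coweight n k) = complex_of_real x"
proof (intro exI conjI)
  let ?x = "\<Sum>l=1..i. of_bool (l \<le> k) - real k / real n"
  show "fund_weight n i (coweight n k) = complex_of_real ?x"
    using assms by (simp add: fund_weight_def sum_weight_apply eps_coweight)
  have "?x = real (card {l. 1 \<le> l \<and> l \<le> i \<and> l \<le> k}) - real i * real k / real n"
    by (simp add: sum_subtractf sum.If_cases of_bool_def Int_def conj_assoc)
  also have "{l. 1 \<le> l \<and> l \<le> i \<and> l \<le> k} = {1..min i k}"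
    by auto
  finally have x: "?x = real (min i k) - real i * real k / real n"
    by simp
  have "real i * real k < real (min i k) * real n"
    using assms by (auto simp: min_def mult.commute[of "real i"])
  then show "0 < ?x"
    unfolding x using assms by (simp add: divide_simps)
qed

lemma dominant_weight_coweight_pos:
  assumes \<mu>: "\<mu> \<in> dominant_weights n" "\<mu> \<noteq> 0" and k: "1 \<le> k" "k < n"
  shows "\<exists>x>0. \<mu> (coweight n k) = complex_of_real x"
proof -
  obtain a where a: "\<mu> = (\<Sum>i=1..n - 1. scale (of_nat (a i)) (fund_weight n i))"
    using \<mu> by (auto simp: dominant_weights_def)
  have "\<forall>i\<in>{1..n - 1}. \<exists>x>0. fund_weight n i (coweight n k) = complex_of_real x"
    using fund_weight_coweight_pos k by auto
  then obtain x where x: "\<And>i. i \<in> {1..n - 1} \<Longrightarrow>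
      x i > 0 \<and> fund_weight n i (coweight n k) = complex_of_real (x i)"
    by metis
  have "\<exists>i\<in>{1..n - 1}. a i \<noteq> 0"
  proof (rule ccontr)
    assume "\<not> ?thesis"
    then have "\<mu> = (\<Sum>i=1..n - 1. 0)"
      unfolding a by (intro sum.cong) (auto simp: scale_def fun_eq_iff)
    with \<mu> show False by simp
  qed
  then obtain i where i: "i \<in> {1..n - 1}" "a i \<noteq> 0" by blast
  have "(\<Sum>i=1..n - 1. real (a i) * x i) > 0"
    using i x by (intro sum_pos2[of _ i]) (auto simp: less_imp_le)
  moreover have "\<mu> (coweight n k) = complex_of_real (\<Sum>i=1..n - 1. real (a i) * x i)"
    unfolding a using x by (simp add: sum_weight_apply scale_def)
  ultimately show ?thesis by blast
qed


section \<open>The coordinates of the highest root plus the half-sum of the positive roots\<close>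

text \<open>
  The values of \<open>\<epsilon>\<^sub>i - \<epsilon>\<^sub>j\<close> at the coweights are the indicator function of \<open>{i..<j}\<close>. So distinct
  pairs give distinct roots, and a sum over the set of roots is a sum over pairs.
\<close>

lemma inj_on_positive_root:
  "inj_on (\<lambda>(j, i). eps n i - eps n j) (SIGMA j:{1..n}. {1..<j})"
proof (rule inj_onI, clarify)
  fix i j i' j'
  assume ij: "j \<in> {1..n}" "i \<in> {1..<j}" and ij': "j' \<in> {1..n}" "i' \<in> {1..<j'}"
    and eq: "eps n i - eps n j = eps n i' - eps n j'"
  have iff: "i \<le> k \<and> k < j \<longleftrightarrow> i' \<le> k \<and> k < j'" if "k \<le> n" for k
    using arg_cong[OF eq, of "\<lambda>f. f (coweight n k)"] that ij ij'
      root_coweight[of i j n k] root_coweight[of i' j' n k]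
    by (auto split: if_splits simp: of_bool_def)
  have "i = i'"
    using iff[of i] iff[of i'] ij ij' by auto
  moreover have "j \<le> j'"
    using iff[of "j - 1"] ij by (cases j) auto
  moreover have "j' \<le> j"
    using iff[of "j' - 1"] ij' by (cases j') auto
  ultimately show "j = j' \<and> i = i'"
    by simp
qed

lemma sum_pairwise_differences:
  fixes x :: "nat \<Rightarrow> 'a::comm_ring_1"
  shows "(\<Sum>j=1..n. \<Sum>i=1..<j. x i - x j) = (\<Sum>i=1..n. (of_nat n + 1 - 2 * of_nat i) * x i)"
proof (induction n)
  case (Suc n)
  have "(\<Sum>j=1..Suc n. \<Sum>i=1..<j. x i - x j) =
      (\<Sum>i=1..n. (of_nat n + 1 - 2 * of_nat i) * x i) + (\<Sum>i=1..n. x i - x (Suc n))"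
    using Suc by (simp add: atLeastLessThanSuc_atLeastAtMost)
  also have "\<dots> = (\<Sum>i=1..Suc n. (of_nat (Suc n) + 1 - 2 * of_nat i) * x i)"
  proof -
    have "(\<Sum>i=1..n. (of_nat (Suc n) + 1 - 2 * of_nat i) * x i) =
        (\<Sum>i=1..n. (of_nat n + 1 - 2 * of_nat i) * x i) + (\<Sum>i=1..n. x i)"
      unfolding sum.distrib[symmetric] by (intro sum.cong) (simp_all add: algebra_simps)
    then show ?thesis
      by (simp add: sum_subtractf)
  qed
  finally show ?case .
qed simp

text \<open>
  The usual coordinate \<open>(n + 1) / 2 - i\<close> is shifted by a constant, which is possible because
  the \<open>\<epsilon>\<^sub>i\<close> add up to \<open>0\<close>; this makes all coordinates integral.
\<close>

lemma rho_eq: "rho n = (\<Sum>i=1..n. scale (- of_nat i) (eps n i))"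
proof
  fix H
  let ?x = "\<lambda>i. eps n i H"
  have roots: "pos_roots n = (\<lambda>(j, i). eps n i - eps n j) ` (SIGMA j:{1..n}. {1..<j})"
    by (force simp: pos_roots_def)
  have "(\<Sum>\<alpha>\<in>pos_roots n. \<alpha>) = (\<Sum>(j, i)\<in>(SIGMA j:{1..n}. {1..<j}). eps n i - eps n j)"
    unfolding roots by (subst sum.reindex[OF inj_on_positive_root]) (simp add: case_prod_beta)
  also have "\<dots> = (\<Sum>j=1..n. \<Sum>i=1..<j. eps n i - eps n j)"
    by (simp add: sum.Sigma)
  finally have "(\<Sum>\<alpha>\<in>pos_roots n. \<alpha>) H = (\<Sum>j=1..n. \<Sum>i=1..<j. ?x i - ?x j)"
    by (simp add: sum_weight_apply)
  also have "\<dots> = (\<Sum>i=1..n. (of_nat n + 1 - 2 * of_nat i) * ?x i)"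
    by (rule sum_pairwise_differences)
  also have "\<dots> = (of_nat n + 1) * (\<Sum>i=1..n. ?x i) + 2 * (\<Sum>i=1..n. - of_nat i * ?x i)"
    by (simp add: sum_distrib_left flip: sum.distrib) (simp add: algebra_simps)
  also have "(\<Sum>i=1..n. ?x i) = 0"
    using arg_cong[OF sum_eps[of n], of "\<lambda>f. f H"] by (simp add: sum_weight_apply)
  finally show "rho n H = (\<Sum>i=1..n. scale (- of_nat i) (eps n i)) H"
    by (simp add: rho_def scale_def sum_weight_apply)
qed

text \<open>
  Coordinates of \<open>\<lambda> + \<rho>\<close> with respect to the \<open>\<epsilon>\<^sub>i\<close>, where \<open>\<lambda>\<close> is the highest root; being linearly
  dependent, the \<open>\<epsilon>\<^sub>i\<close> determine them only up to a common constant. Adding \<open>\<rho>\<close> makes the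
  coordinates strictly decreasing, which is what forces \<open>\<sigma> = 1\<close> in the end.
\<close>

definition shifted_coord :: "nat \<Rightarrow> nat \<Rightarrow> int" where
  "shifted_coord n i = of_bool (i = 1) - of_bool (i = n) - int i"

lemma shifted_coord_strict_antimono:
  assumes "1 \<le> i" "i < j" "j \<le> n"
  shows "shifted_coord n j < shifted_coord n i"
  using assms by (auto simp: shifted_coord_def)

lemma highest_root_add_rho:
  assumes "n \<ge> 1"
  shows "highest_root n + rho n = (\<Sum>i=1..n. scale (of_int (shifted_coord n i)) (eps n i))"
proof
  fix H
  let ?x = "\<lambda>i. eps n i H"
  have "(\<Sum>i=1..n. of_int (shifted_coord n i) * ?x i) =
      (\<Sum>i=1..n. if i = 1 then ?x i else 0) - (\<Sum>i=1..n. if i = n then ?x i else 0)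
        + (\<Sum>i=1..n. - of_nat i * ?x i)"
    unfolding sum.distrib[symmetric] sum_subtractf[symmetric]
    by (intro sum.cong) (auto simp: shifted_coord_def algebra_simps)
  then show "(highest_root n + rho n) H =
      (\<Sum>i=1..n. scale (of_int (shifted_coord n i)) (eps n i)) H"
    using assms by (simp add: highest_root_def rho_eq sum_weight_apply scale_def)
qed

lemma weyl_act_sum_eps:
  assumes "\<sigma> permutes {1..n}"
  shows "weyl_act n \<sigma> (\<Sum>i=1..n. scale (c i) (eps n i)) = (\<Sum>i=1..n. scale (c i) (eps n (\<sigma> i)))"
proof -
  have zero: "weyl_act n \<sigma> 0 = 0"
    by (rule ext) (simp add: weyl_act_def)
  have "weyl_act n \<sigma> (\<Sum>i=1..n. scale (c i) (eps n i)) =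
      (\<Sum>i=1..n. weyl_act n \<sigma> (scale (c i) (eps n i)))"
    by (rule sum_comp_morphism[of "weyl_act n \<sigma>", OF zero weyl_act_add, unfolded comp_def, symmetric])
  also have "\<dots> = (\<Sum>i=1..n. scale (c i) (eps n (\<sigma> i)))"
    by (intro sum.cong) (simp_all only: weyl_act_scale weyl_act_eps[OF assms])
  finally show ?thesis .
qed

lemma sum_eps_permuted_coweight:
  assumes \<sigma>: "\<sigma> permutes {1..n}" and k: "k \<le> n"
  shows "(\<Sum>i=1..n. scale (of_int (c i)) (eps n (\<sigma> i))) (coweight n k) =
    of_int (\<Sum>i\<in>{i\<in>{1..n}. \<sigma> i \<le> k}. c i) - of_real (real k / real n) * of_int (\<Sum>i=1..n. c i)"
proof -
  have "(\<Sum>i=1..n. scale (of_int (c i)) (eps n (\<sigma> i))) (coweight n k) =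
      (\<Sum>i=1..n. of_int (c i) * of_real (of_bool (\<sigma> i \<le> k) - real k / real n))"
    unfolding sum_weight_apply scale_def
  proof (rule sum.cong)
    fix i assume "i \<in> {1..n}"
    then have "\<sigma> i \<in> {1..n}" using permutes_in_image[OF \<sigma>] by simp
    then show "of_int (c i) * eps n (\<sigma> i) (coweight n k) =
        of_int (c i) * of_real (of_bool (\<sigma> i \<le> k) - real k / real n)"
      using k by (simp add: eps_coweight)
  qed simp
  also have "\<dots> = (\<Sum>i=1..n. if \<sigma> i \<le> k then of_int (c i) else 0)
      - of_real (real k / real n) * (\<Sum>i=1..n. of_int (c i))"
    unfolding sum_distrib_left sum_subtractf[symmetric]
    by (intro sum.cong) (auto simp: algebra_simps)
  also have "(\<Sum>i=1..n. if \<sigma> i \<le> k then complex_of_int (c i) else 0) =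
      (\<Sum>i\<in>{i\<in>{1..n}. \<sigma> i \<le> k}. of_int (c i))"
    by (simp only: sum.inter_filter finite_atLeastAtMost)
  finally show ?thesis
    by (simp only: of_int_sum)
qed


section \<open>Strictly decreasing coordinates and permutations\<close>

text \<open>
  The elements of \<open>S\<close> outside \<open>{1..k}\<close> are as many as those of \<open>{1..k}\<close> outside \<open>S\<close>; the value
  of \<open>f\<close> at \<open>k\<close> separates the values at the former from those at the latter.
\<close>

lemma sum_less_sum_initial_segment:
  fixes f :: "nat \<Rightarrow> 'a::linordered_idom"
  assumes dec: "\<And>i j. 1 \<le> i \<Longrightarrow> i < j \<Longrightarrow> j \<le> n \<Longrightarrow> f j < f i"
    and S: "S \<subseteq> {1..n}" "card S = k" "S \<noteq> {1..k}" and k: "k \<le> n"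
  shows "sum f S < sum f {1..k}"
proof -
  let ?K = "{1..k}"
  have fin: "finite S" using S finite_subset by blast
  have "card (S - ?K) = card (?K - S)"
    using S fin card_Diff_subset_Int[of S ?K] card_Diff_subset_Int[of ?K S]
    by (simp add: Int_commute)
  moreover have "S - ?K \<noteq> {}"
    using S fin card_subset_eq[of ?K S] by auto
  ultimately have "sum f (S - ?K) < of_nat (card (?K - S)) * f k"
    using sum_strict_mono[of "S - ?K" f "\<lambda>_. f k"] fin S dec \<open>k \<le> n\<close>
    by (cases "k = 0") (force simp: subset_iff)+
  also have "\<dots> \<le> sum f (?K - S)"
  proof (rule sum_bounded_below)
    fix i assume "i \<in> ?K - S"
    then show "f k \<le> f i"
      using dec[of i k] k by (cases "i = k") auto
  qed
  finally show ?thesis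
    using fin sum.Int_Diff[of S f ?K] sum.Int_Diff[of ?K f S] by (simp add: Int_commute)
qed

lemma card_permutes_vimage_initial_segment:
  assumes "\<sigma> permutes {1..n}" and "k \<le> n"
  shows "card {i\<in>{1..n}. \<sigma> i \<le> k} = k"
proof -
  have img: "\<sigma> ` {i\<in>{1..n}. \<sigma> i \<le> k} = {1..k}"
  proof (rule equalityI; rule subsetI)
    fix j assume "j \<in> {1..k}"
    moreover from this have "j \<in> \<sigma> ` {1..n}"
      using permutes_image[OF assms(1)] assms(2) by simp
    ultimately show "j \<in> \<sigma> ` {i\<in>{1..n}. \<sigma> i \<le> k}" by auto
  next
    fix j assume "j \<in> \<sigma> ` {i\<in>{1..n}. \<sigma> i \<le> k}"
    then show "j \<in> {1..k}"
      using permutes_in_image[OF assms(1)] by fastforce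
  qed
  have "inj_on \<sigma> {i\<in>{1..n}. \<sigma> i \<le> k}"
    using permutes_inj[OF assms(1)] by (rule inj_on_subset) simp
  from card_image[OF this] show ?thesis
    unfolding img by simp
qed

lemma permutes_eq_id_if_initial_segments_preserved:
  fixes n :: nat
  assumes \<sigma>: "\<sigma> permutes {1..n}"
    and pres: "\<And>k. 1 \<le> k \<Longrightarrow> k < n \<Longrightarrow> {i\<in>{1..n}. \<sigma> i \<le> k} = {1..k}"
  shows "\<sigma> = id"
proof
  fix i
  show "\<sigma> i = id i"
  proof (cases "i \<in> {1..n}")
    case True
    then have \<sigma>i: "\<sigma> i \<in> {1..n}" using permutes_in_image[OF \<sigma>] by simp
    have "\<sigma> i \<le> k \<longleftrightarrow> i \<le> k" if "1 \<le> k" "k < n" for k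
      using pres[OF that] True by (auto simp: set_eq_iff)
    from this[of i] this[of "\<sigma> i"]
    have "i < n \<Longrightarrow> \<sigma> i \<le> i" "\<sigma> i < n \<Longrightarrow> i \<le> \<sigma> i"
      using True \<sigma>i by auto
    then show ?thesis
      using True \<sigma>i by (cases "i < n"; cases "\<sigma> i < n") auto
  next
    case False
    then show ?thesis using \<sigma> by (simp add: permutes_not_in)
  qed
qed


section \<open>Weyl alternation sets of the highest root\<close>

lemma kostant_partition_pos_iff:
  "kostant_partition n \<xi> > 0 \<longleftrightarrow>
    (\<exists>m. (\<Sum>\<beta>\<in>pos_roots n. scale (of_nat (m \<beta>)) \<beta>) = \<xi>)"
proof -
  have "kostant_functions n \<xi> \<noteq> {}"
    if "(\<Sum>\<beta>\<in>pos_roots n. scale (of_nat (m \<beta>)) \<beta>) = \<xi>" for m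
  proof -
    have "restrict m (pos_roots n) \<in> kostant_functions n \<xi>"
      using that by (auto simp: kostant_functions_def)
    then show ?thesis by blast
  qed
  moreover have "kostant_functions n \<xi> \<noteq> {} \<Longrightarrow>
      \<exists>m. (\<Sum>\<beta>\<in>pos_roots n. scale (of_nat (m \<beta>)) \<beta>) = \<xi>"
    by (auto simp: kostant_functions_def)
  ultimately show ?thesis
    using finite_kostant_functions[of n \<xi>]
    by (auto simp: kostant_partition_def card_gt_0_iff)
qed

lemma root_sum_coweight:
  assumes "k \<le> n"
  shows "(\<Sum>\<beta>\<in>pos_roots n. scale (of_nat (m \<beta>)) \<beta>) (coweight n k) =
    of_nat (\<Sum>\<beta> | \<beta> \<in> pos_roots n \<and> \<beta> (coweight n k) = 1. m \<beta>)"
proof -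
  have "of_nat (m \<beta>) * \<beta> (coweight n k) = (if \<beta> (coweight n k) = 1 then of_nat (m \<beta>) else 0)"
    if "\<beta> \<in> pos_roots n" for \<beta>
  proof -
    have "\<beta> (coweight n k) \<in> {0, 1}"
      using that assms root_coweight by (fastforce simp: pos_roots_def)
    then show ?thesis by auto
  qed
  then show ?thesis
    by (simp add: sum_weight_apply scale_def sum.inter_filter[OF finite_pos_roots] if_distrib[of of_nat] cong: if_cong)
qed

text \<open>Each positive root takes the value \<open>1\<close> at some fundamental coweight.\<close>

lemma root_sum_eq_0:
  assumes "\<And>k. 1 \<le> k \<Longrightarrow> k < n \<Longrightarrow>
    (\<Sum>\<beta>\<in>pos_roots n. scale (of_nat (m \<beta>)) \<beta>) (coweight n k) = 0"
  shows "(\<Sum>\<beta>\<in>pos_roots n. scale (of_nat (m \<beta>)) \<beta>) = 0"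
proof (rule sum.neutral, rule ballI)
  fix \<beta> assume \<beta>: "\<beta> \<in> pos_roots n"
  then obtain i j where ij: "1 \<le> i" "i < j" "j \<le> n" "\<beta> = eps n i - eps n j"
    by (auto simp: pos_roots_def)
  have "(\<Sum>\<beta> | \<beta> \<in> pos_roots n \<and> \<beta> (coweight n i) = 1. m \<beta>) = 0"
    using assms[of i] root_sum_coweight[of i n m] ij by (simp del: of_nat_sum)
  moreover have "\<beta> (coweight n i) = 1"
    using ij root_coweight[of i j n i] by simp
  ultimately have "m \<beta> = 0"
    using \<beta> finite_pos_roots[of n] by auto
  then show "scale (of_nat (m \<beta>)) \<beta> = 0"
    by (simp add: scale_def fun_eq_iff)
qed

text \<open>
  Integrality at a single coweight: \<open>N\<^sub>k + d\<^sub>k = 1 - \<mu>(H\<^sub>k)\<close> is an integer below \<open>1\<close>, and both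
  summands on the left are non-negative.
\<close>

lemma alternation_squeeze_at_coweight:
  assumes \<sigma>: "\<sigma> permutes {1..n}" and k: "1 \<le> k" "k < n"
    and \<mu>: "\<mu> \<in> dominant_weights n" "\<mu> \<noteq> 0"
    and sum: "(\<Sum>\<beta>\<in>pos_roots n. scale (of_nat (m \<beta>)) \<beta>) =
      weyl_act n \<sigma> (highest_root n + rho n) - (\<mu> + rho n)"
  shows "{i\<in>{1..n}. \<sigma> i \<le> k} = {1..k}"
    and "(\<Sum>\<beta>\<in>pos_roots n. scale (of_nat (m \<beta>)) \<beta>) (coweight n k) = 0"
proof -
  let ?S = "{i\<in>{1..n}. \<sigma> i \<le> k}" and ?c = "shifted_coord n" and ?H = "coweight n k"
  let ?R = "\<Sum>\<beta>\<in>pos_roots n. scale (of_nat (m \<beta>)) \<beta>"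
  define d where "d = sum ?c {1..k} - sum ?c ?S"
  obtain x where x: "x > 0" "\<mu> ?H = complex_of_real x"
    using dominant_weight_coweight_pos[OF \<mu> k] by blast
  obtain N where N: "?R ?H = of_nat N"
    using root_sum_coweight[of k n m] k by (auto simp del: of_nat_sum)
  have hr: "highest_root n ?H = 1"
    using root_coweight[of 1 n n k] k by (simp add: highest_root_def)
  have initial: "{i\<in>{1..n}. id i \<le> k} = {1..k}"
    using k by auto
  define w where "w = weyl_act n \<sigma> (highest_root n + rho n)"
  have w: "w ?H = of_int (sum ?c ?S) - of_real (real k / real n) * of_int (sum ?c {1..n})"
    using sum_eps_permuted_coweight[OF \<sigma>, of k ?c] weyl_act_sum_eps[OF \<sigma>] k
    unfolding w_def by (simp add: highest_root_add_rho)
  have "(highest_root n + rho n) ?H =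
      of_int (sum ?c {1..k}) - of_real (real k / real n) * of_int (sum ?c {1..n})"
    using sum_eps_permuted_coweight[OF permutes_id, of k n ?c] k initial
    by (simp add: highest_root_add_rho)
  then have hr_rho: "highest_root n ?H + rho n ?H =
      of_int (sum ?c {1..k}) - of_real (real k / real n) * of_int (sum ?c {1..n})"
    by simp
  have "?R = w - (\<mu> + rho n)"
    unfolding w_def by (rule sum)
  then have "?R ?H = w ?H - (\<mu> ?H + rho n ?H)"
    by simp
  then have "of_nat N = w ?H - (\<mu> ?H + rho n ?H)"
    unfolding N .
  also have "\<dots> = highest_root n ?H - of_int d - \<mu> ?H"
  proof -
    have "w ?H = highest_root n ?H + rho n ?H - of_int d"
      unfolding w hr_rho d_def of_int_diff by simp
    then show ?thesis by simp
  qed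
  finally have "complex_of_real (real N) = complex_of_real (1 - of_int d - x)"
    using hr x by simp
  then have "real N = 1 - of_int d - x"
    by (simp only: of_real_eq_iff)
  then have less: "int N + d < 1"
    using x by linarith
  have d: "d > 0" if "?S \<noteq> {1..k}"
  proof -
    have "sum ?c ?S < sum ?c {1..k}"
      using k card_permutes_vimage_initial_segment[OF \<sigma>, of k] that
      by (intro sum_less_sum_initial_segment[of n] shifted_coord_strict_antimono) (simp_all, auto)
    then show ?thesis
      by (simp only: d_def)
  qed
  show S: "?S = {1..k}"
    using d less by linarith
  have "d = 0"
    unfolding d_def S by simp
  then show "?R ?H = 0"
    using less N by simp
qed

theorem theorem4p1:
  fixes r n :: nat and \<mu> :: weight
  assumes "r \<ge> 1" and "n = r + 1"
    and "\<mu> \<in> dominant_weights n" and "\<mu> \<noteq> 0"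
  shows "weyl_alternation_set n (highest_root n) \<mu> = (if \<mu> = highest_root n then {id} else {})"
proof -
  have id_act: "weyl_act n id (highest_root n + rho n) = highest_root n + rho n"
    using weyl_act_sum_eps[OF permutes_id, of n] assms by (simp add: highest_root_add_rho)
  have forward: "\<sigma> = id \<and> \<mu> = highest_root n"
    if \<sigma>_mem: "\<sigma> \<in> weyl_alternation_set n (highest_root n) \<mu>" for \<sigma>
  proof -
    have \<sigma>: "\<sigma> permutes {1..n}"
      using \<sigma>_mem by (simp add: weyl_alternation_set_def weyl_group_def)
    obtain m where m: "(\<Sum>\<beta>\<in>pos_roots n. scale (of_nat (m \<beta>)) \<beta>) =
        weyl_act n \<sigma> (highest_root n + rho n) - (\<mu> + rho n)"
      using \<sigma>_mem by (auto simp: weyl_alternation_set_def kostant_partition_pos_iff)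
    note squeeze = alternation_squeeze_at_coweight[OF \<sigma> _ _ assms(3,4) m]
    have "\<sigma> = id"
      using permutes_eq_id_if_initial_segments_preserved[OF \<sigma>] squeeze(1) by blast
    moreover have "weyl_act n \<sigma> (highest_root n + rho n) - (\<mu> + rho n) = 0"
      using root_sum_eq_0[of n m] squeeze(2) m by simp
    ultimately show ?thesis
      using id_act by simp
  qed
  have backward: "id \<in> weyl_alternation_set n (highest_root n) (highest_root n)"
  proof -
    have "(\<Sum>\<beta>\<in>pos_roots n. scale (of_nat 0) \<beta>) =
        weyl_act n id (highest_root n + rho n) - (highest_root n + rho n)"
      by (simp add: id_act scale_def fun_eq_iff sum_weight_apply)
    then have "kostant_partition n
        (weyl_act n id (highest_root n + rho n) - (highest_root n + rho n)) > 0"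
      unfolding kostant_partition_pos_iff by (intro exI[of _ "\<lambda>_. 0"])
    then show ?thesis
      by (simp add: weyl_alternation_set_def weyl_group_def permutes_id)
  qed
  show ?thesis
  proof (cases "\<mu> = highest_root n")
    case True
    then show ?thesis
      using forward backward by auto
  next
    case False
    then show ?thesis
      using forward by auto
  qed
qed

end
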